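(* Let $\mathcal{G}$ be a geometric algebra, $A_r$ an invertible $r$-blade, and $b_1,\dotsc,b_s\in\mathcal{G}_1$ vectors ($s\ge 1$). Then $$P_{A_r}(b_1)\wedge\dotsb\wedge P_{A_r}(b_s)=\big((b_1\wedge\dotsb\wedge b_s)\rfloor A_r\big)A_r^{-1},$$ $$R_{A_r}(b_1)\wedge\dotsb\wedge R_{A_r}(b_s)=\big((b_1\wedge\dotsb\wedge b_s)\wedge A_r\big)A_r^{-1}.$$
   Context: A geometric algebra $\mathcal{G}$ is a ring with unit containing a field $\mathcal{G}_0$ of characteristic zero (the scalars, with $0,1\in\mathcal{G}_0$) and a subset $\mathcal{G}_1$ (the vectors) closed under addition with $\lambda v=v\lambda\in\mathcal{G}_1$ for all $\lambda\in\mathcal{G}_0$, $v\in\mathcal{G}_1$ (so $\mathcal{G}_1$ is a $\mathcal{G}_0$-vector space), such that: the square of every vector is a scalar; the symmetric bilinear inner product of vectors $u\rfloor v=\frac12(uv+vu)\in\mathcal{G}_0$ is nondegenerate (the only vector orthogonal to all vectors is $0$); and $\mathcal{G}$ is the direct sum of the subspaces $\mathcal{G}_r$, $r\ge 0$, defined as follows. Vectors $u,v$ are orthogonal if $u\rfloor v=0$. For $r\ge 2$ an $r$-blade is a product of $r$ pairwise orthogonal vectors; $0$-blades are the scalars and $1$-blades the vectors. An $r$-vector is a finite sum of $r$-blades, and $\mathcal{G}_r$ is the set of $r$-vectors. $\langle A\rangle_r$ denotes the component of $A\in\mathcal{G}$ in $\mathcal{G}_r$, with $\langle A\rangle_r=0$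 for $r<0$. For $A=\sum_rA_r$ and $B=\sum_sB_s$ with $A_r\in\mathcal{G}_r$, $B_s\in\mathcal{G}_s$: $A\rfloor B:=\sum_{r,s}\langle A_rB_s\rangle_{s-r}$ and $A\wedge B:=\sum_{r,s}\langle A_rB_s\rangle_{r+s}$ (the latter is associative). A blade is invertible if it has a multiplicative inverse in $\mathcal{G}$. For an invertible blade $A_r$ and a vector $a$, the orthogonal projection of $a$ into, and orthogonal rejection of $a$ from, the subspace represented by $A_r$ are the vectors $P_{A_r}(a)=(a\rfloor A_r)A_r^{-1}$ and $R_{A_r}(a)=(a\wedge A_r)A_r^{-1}$; they satisfy $P_{A_r}(a)+R_{A_r}(a)=a$. *)

theory Defs
  imports Main
begin

text \<open>
  The ambient ring is the type \<open>'a\<close>; the scalars \<open>G0\<close> and the vectors \<open>G1\<close> are subsets of it.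
\<close>

definition mult_invertible :: "'a::ring_1 \<Rightarrow> bool" where
  "mult_invertible x \<longleftrightarrow> (\<exists>y. x * y = 1 \<and> y * x = 1)"

definition mult_inv :: "'a::ring_1 \<Rightarrow> 'a" where
  "mult_inv x = (THE y. x * y = 1 \<and> y * x = 1)"

text \<open>
  The factor \<open>1/2\<close> is the inverse of \<open>2\<close> in the ring; when \<open>G0\<close> is a subfield of characteristic
  zero, this is the inverse of \<open>2\<close> in \<open>G0\<close>.
\<close>

definition vec_inner :: "'a::ring_1 \<Rightarrow> 'a \<Rightarrow> 'a" where
  "vec_inner u v = mult_inv 2 * (u * v + v * u)"

text \<open>
  Orthogonality is required between factors at different positions, so a null vector
  may be repeated; the resulting blade is \<open>0\<close>.
\<close>

definition blades :: "'a::ring_1 set \<Rightarrow> 'a set \<Rightarrow> nat \<Rightarrow> 'a set" where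
  "blades G0 G1 r =
    (if r = 0 then G0
     else if r = 1 then G1
     else {prod_list vs | vs. length vs = r \<and> set vs \<subseteq> G1 \<and>
             (\<forall>i<r. \<forall>j<r. i \<noteq> j \<longrightarrow> vec_inner (vs ! i) (vs ! j) = 0)})"

definition multivecs :: "'a::ring_1 set \<Rightarrow> 'a set \<Rightarrow> nat \<Rightarrow> 'a set" where
  "multivecs G0 G1 r = {sum_list Bs | Bs. set Bs \<subseteq> blades G0 G1 r}"

definition is_grading :: "'a::ring_1 set \<Rightarrow> 'a set \<Rightarrow> 'a \<Rightarrow> (nat \<Rightarrow> 'a) \<Rightarrow> bool" where
  "is_grading G0 G1 A f \<longleftrightarrow>
    (\<forall>r. f r \<in> multivecs G0 G1 r) \<and> finite {r. f r \<noteq> 0} \<and> A = (\<Sum>r | f r \<noteq> 0. f r)"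

text \<open>
  The class \<open>ring_char_0\<close> states that the characteristic is zero; it is the same for the ring
  and for \<open>G0\<close>, since they share \<open>1\<close>.
\<close>

locale geometric_algebra =
  fixes G0 G1 :: "'a::ring_char_0 set"
  assumes scalar_zero: "0 \<in> G0"
    and scalar_one: "1 \<in> G0"
    and scalar_add: "\<lbrakk>a \<in> G0; b \<in> G0\<rbrakk> \<Longrightarrow> a + b \<in> G0"
    and scalar_uminus: "a \<in> G0 \<Longrightarrow> - a \<in> G0"
    and scalar_mult: "\<lbrakk>a \<in> G0; b \<in> G0\<rbrakk> \<Longrightarrow> a * b \<in> G0"
    and scalar_commute: "\<lbrakk>a \<in> G0; b \<in> G0\<rbrakk> \<Longrightarrow> a * b = b * a"
    and scalar_inverse: "\<lbrakk>a \<in> G0; a \<noteq> 0\<rbrakk> \<Longrightarrow> \<exists>b\<in>G0. a * b = 1"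
    and vector_zero: "0 \<in> G1"
    and vector_add: "\<lbrakk>u \<in> G1; v \<in> G1\<rbrakk> \<Longrightarrow> u + v \<in> G1"
    and vector_scale: "\<lbrakk>a \<in> G0; v \<in> G1\<rbrakk> \<Longrightarrow> a * v \<in> G1"
    and vector_scale_commute: "\<lbrakk>a \<in> G0; v \<in> G1\<rbrakk> \<Longrightarrow> a * v = v * a"
    and vector_square: "v \<in> G1 \<Longrightarrow> v * v \<in> G0"
    and nondegenerate: "\<lbrakk>v \<in> G1; \<And>u. u \<in> G1 \<Longrightarrow> vec_inner v u = 0\<rbrakk> \<Longrightarrow> v = 0"
    and direct_sum: "\<exists>!f. is_grading G0 G1 A f"

definition component :: "'a::ring_1 set \<Rightarrow> 'a set \<Rightarrow> 'a \<Rightarrow> nat \<Rightarrow> 'a" where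
  "component G0 G1 A = (THE f. is_grading G0 G1 A f)"

definition grade_part :: "'a::ring_1 set \<Rightarrow> 'a set \<Rightarrow> 'a \<Rightarrow> int \<Rightarrow> 'a" where
  "grade_part G0 G1 A k = (if k < 0 then 0 else component G0 G1 A (nat k))"

definition contraction :: "'a::ring_1 set \<Rightarrow> 'a set \<Rightarrow> 'a \<Rightarrow> 'a \<Rightarrow> 'a" where
  "contraction G0 G1 A B =
    (\<Sum>r | component G0 G1 A r \<noteq> 0. \<Sum>s | component G0 G1 B s \<noteq> 0.
      grade_part G0 G1 (component G0 G1 A r * component G0 G1 B s) (int s - int r))"

definition wedge :: "'a::ring_1 set \<Rightarrow> 'a set \<Rightarrow> 'a \<Rightarrow> 'a \<Rightarrow> 'a" where
  "wedge G0 G1 A B =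
    (\<Sum>r | component G0 G1 A r \<noteq> 0. \<Sum>s | component G0 G1 B s \<noteq> 0.
      grade_part G0 G1 (component G0 G1 A r * component G0 G1 B s) (int r + int s))"

text \<open>
  The product is bracketed to the right; in a geometric algebra \<open>wedge\<close> is associative, so the
  bracketing is immaterial. The value for the empty list is a convention.
\<close>

fun wedge_list :: "'a::ring_1 set \<Rightarrow> 'a set \<Rightarrow> 'a list \<Rightarrow> 'a" where
  "wedge_list G0 G1 [] = 1"
| "wedge_list G0 G1 [b] = b"
| "wedge_list G0 G1 (b # c # bs) = wedge G0 G1 b (wedge_list G0 G1 (c # bs))"

definition projection :: "'a::ring_1 set \<Rightarrow> 'a set \<Rightarrow> 'a \<Rightarrow> 'a \<Rightarrow> 'a" where
  "projection G0 G1 A a = contraction G0 G1 a A * mult_inv A"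

definition rejection :: "'a::ring_1 set \<Rightarrow> 'a set \<Rightarrow> 'a \<Rightarrow> 'a \<Rightarrow> 'a" where
  "rejection G0 G1 A a = wedge G0 G1 a A * mult_inv A"

end

theory Submission
  imports Defs
begin

text \<open>
  For a vector \<open>a\<close> and an \<open>s\<close>-vector \<open>B\<close>, the elements \<open>a B + (-1)\<^sup>s B a\<close> and \<open>a B - (-1)\<^sup>s B a\<close> are
  homogeneous of degree \<open>s + 1\<close> and \<open>s - 1\<close>, so they are \<open>2 (a \<and> B)\<close> and \<open>2 (a \<rfloor> B)\<close>. Comparing the
  extreme grades of \<open>a B A\<close> gives \<open>(a \<and> B) \<and> A = a \<and> (B \<and> A)\<close> and \<open>(a \<and> B) \<rfloor> A = a \<rfloor> (B \<rfloor> A)\<close>.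
  The factors of an invertible blade \<open>A\<close> of grade \<open>r\<close> are not null, so every vector \<open>b\<close> splits as
  \<open>p + q\<close> with \<open>p A = - (-1)\<^sup>r A p\<close> and \<open>q A = (-1)\<^sup>r A q\<close>; these are its projection and rejection,
  and any such \<open>p\<close> and \<open>q\<close> anticommute. The theorem follows by induction on the number of vectors:
  if \<open>(b\<^sub>2 \<and> \<dots> \<and> b\<^sub>s) \<rfloor> A = C A\<close> with \<open>C\<close> the outer product of the projections, then in \<open>b\<^sub>1 \<rfloor> (C A)\<close>
  the rejection of \<open>b\<^sub>1\<close> cancels and its projection \<open>p\<close> gives \<open>(p \<and> C) A\<close>; dually for rejections.
\<close>

section \<open>Inverses and signs in a ring with unit\<close>

lemma mult_inv_eqI:
  assumes "x * y = 1" "y * x = 1"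
  shows "mult_inv x = y"
  unfolding mult_inv_def
proof (rule the_equality)
  fix z assume "x * z = 1 \<and> z * x = 1"
  then have "z = z * (x * y)" using assms by simp
  also have "\<dots> = y" using \<open>x * z = 1 \<and> z * x = 1\<close> by (simp flip: mult.assoc)
  finally show "z = y" .
qed (use assms in simp)

lemma mult_inv_left: "mult_invertible x \<Longrightarrow> mult_inv x * x = 1"
  unfolding mult_invertible_def using mult_inv_eqI by metis

lemma mult_inv_right: "mult_invertible x \<Longrightarrow> x * mult_inv x = 1"
  unfolding mult_invertible_def using mult_inv_eqI by metis

text \<open>Splitting on the sign lets the simplifier settle identities with \<open>(-1) ^ k\<close>
  without moving the power past noncommuting factors.\<close>

lemma neg_one_power_cases:
  obtains "(-1) ^ k = (1::'a::ring_1)" | "(-1) ^ k = (-1::'a)"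
  by (cases "even k") auto

context geometric_algebra
begin

abbreviation "G \<equiv> multivecs G0 G1"
abbreviation "cmp \<equiv> component G0 G1"
abbreviation "gp \<equiv> grade_part G0 G1"

text \<open>The anticommutator avoids the factor one half, and \<open>sorted_wrt\<close> suits
  induction on the list; one order of each pair is enough by symmetry.\<close>

definition orthogonal_list :: "'a list \<Rightarrow> bool" where
  "orthogonal_list vs \<longleftrightarrow> set vs \<subseteq> G1 \<and> sorted_wrt (\<lambda>u v. u * v + v * u = 0) vs"

lemma orthogonal_list_Nil [simp]: "orthogonal_list []"
  by (simp add: orthogonal_list_def)

lemma orthogonal_list_Cons:
  "orthogonal_list (v # vs) \<longleftrightarrow>
     v \<in> G1 \<and> (\<forall>u\<in>set vs. v * u + u * v = 0) \<and> orthogonal_list vs"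
  by (auto simp: orthogonal_list_def)

section \<open>Scalars, vectors and division by two\<close>

lemma scalar_of_nat: "of_nat n \<in> G0"
  by (induction n) (auto simp: scalar_zero scalar_one scalar_add)

lemma scalar_diff: "a \<in> G0 \<Longrightarrow> b \<in> G0 \<Longrightarrow> a - b \<in> G0"
  using scalar_add[of a "- b"] scalar_uminus by simp

lemma vector_uminus: "v \<in> G1 \<Longrightarrow> - v \<in> G1"
  using vector_scale[of "- 1" v] scalar_one scalar_uminus by simp

lemma vector_diff: "u \<in> G1 \<Longrightarrow> v \<in> G1 \<Longrightarrow> u - v \<in> G1"
  using vector_add[of u "- v"] vector_uminus by simp

lemma half_scalar: "mult_inv 2 \<in> G0" and two_half: "2 * mult_inv 2 = (1::'a)"
  and half_two: "mult_inv 2 * 2 = (1::'a)"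
proof -
  have "2 \<in> G0" using scalar_of_nat[of 2] by simp
  then obtain h where h: "h \<in> G0" "2 * h = 1"
    using scalar_inverse[of 2] by auto
  with \<open>2 \<in> G0\<close> have "h * 2 = 1" using scalar_commute by metis
  then have "mult_inv 2 = h" using h mult_inv_eqI by blast
  then show "mult_inv 2 \<in> G0" "2 * mult_inv 2 = (1::'a)" "mult_inv 2 * 2 = (1::'a)"
    using h \<open>h * 2 = 1\<close> by auto
qed

lemma half_double: "mult_inv 2 * (x + x) = (x::'a)"
proof -
  have "mult_inv 2 * (x + x) = mult_inv 2 * 2 * x"
    by (simp only: mult_2 mult.assoc)
  then show ?thesis by (simp add: half_two)
qed

lemma double_eq_0: "x + x = 0 \<Longrightarrow> x = (0::'a)"
  using half_double[of x] by simp

lemma vec_inner_eq_0_iff: "vec_inner u v = 0 \<longleftrightarrow> u * v + v * u = (0::'a)"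
proof -
  have "u * v + v * u = 2 * vec_inner u v"
    unfolding vec_inner_def mult.assoc[symmetric] by (simp add: two_half)
  then show ?thesis by (auto simp: vec_inner_def)
qed

text \<open>Polarization: the anticommutator is the square of \<open>u + v\<close> minus the squares
  of \<open>u\<close> and \<open>v\<close>.\<close>

lemma anticommutator_scalar:
  assumes "u \<in> G1" "v \<in> G1"
  shows "u * v + v * u \<in> G0"
proof -
  have "u * v + v * u = (u + v) * (u + v) - u * u - v * v"
    by (simp add: algebra_simps)
  then show ?thesis using assms by (simp add: vector_square vector_add scalar_diff)
qed

section \<open>Blades as scaled orthogonal products\<close>

text \<open>The scalar is absorbed into the first factor, which stays orthogonal to the others.
  Together with \<open>bladesE\<close> this replaces the three cases of \<open>blades\<close> by one
  form, with the empty product in grade 0.\<close>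

lemma blades_scaled_prod_list:
  assumes "orthogonal_list vs" "c \<in> G0"
  shows "c * prod_list vs \<in> blades G0 G1 (length vs)"
proof (cases vs)
  case Nil
  then show ?thesis using assms by (simp add: blades_def)
next
  case (Cons v us)
  let ?ws = "(c * v) # us"
  have v: "v \<in> G1" and us: "set us \<subseteq> G1"
    using assms Cons by (auto simp: orthogonal_list_def)
  have "(c * v) * u + u * (c * v) = 0" if "u \<in> set us" for u
  proof -
    have "u * (c * v) = c * (u * v)"
      using vector_scale_commute[of c u] that us assms(2) by (auto simp flip: mult.assoc)
    then have "(c * v) * u + u * (c * v) = c * (v * u + u * v)"
      by (simp add: mult.assoc distrib_left)
    then show ?thesis using that assms(1) Cons by (simp add: orthogonal_list_Cons)
  qed
  then have o: "orthogonal_list ?ws"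
    using assms Cons v by (simp add: orthogonal_list_Cons vector_scale)
  have eq: "c * prod_list vs = prod_list ?ws" using Cons by (simp add: mult.assoc)
  show ?thesis
  proof (cases "us = []")
    case True
    then show ?thesis using Cons o eq by (simp add: blades_def orthogonal_list_def)
  next
    case False
    have "vec_inner (?ws ! i) (?ws ! j) = 0"
      if "i < length ?ws" "j < length ?ws" "i \<noteq> j" for i j
    proof -
      have *: "?ws ! i * ?ws ! j + ?ws ! j * ?ws ! i = 0" if "i < j" "j < length ?ws" for i j
        using o that unfolding orthogonal_list_def sorted_wrt_iff_nth_less by blast
      show ?thesis
        using that *[of i j] *[of j i]
        by (cases "i < j") (simp_all add: vec_inner_eq_0_iff add.commute)
    qed
    then show ?thesis
      unfolding eq using False Cons o
      by (auto simp: blades_def orthogonal_list_def intro!: exI[of _ ?ws])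
  qed
qed

lemma bladesE:
  assumes "B \<in> blades G0 G1 r"
  obtains c vs where "c \<in> G0" "orthogonal_list vs" "length vs = r" "B = c * prod_list vs"
proof -
  consider "r = 0" | "r = 1" | "r \<ge> 2" by linarith
  then show ?thesis
  proof cases
    case 1
    then show ?thesis using assms that[of B "[]"] by (simp add: blades_def)
  next
    case 2
    then show ?thesis using assms that[of 1 "[B]"] scalar_one
      by (simp add: blades_def orthogonal_list_Cons)
  next
    case 3
    then obtain vs where vs: "B = prod_list vs" "length vs = r" "set vs \<subseteq> G1"
      "\<forall>i<r. \<forall>j<r. i \<noteq> j \<longrightarrow> vec_inner (vs ! i) (vs ! j) = 0"
      using assms by (auto simp: blades_def)
    then have "orthogonal_list vs"
      by (auto simp: orthogonal_list_def sorted_wrt_iff_nth_less vec_inner_eq_0_iff)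
    then show ?thesis using vs that[of 1 vs] scalar_one by simp
  qed
qed

section \<open>Multivectors of one grade\<close>

lemma multivecs_zero: "0 \<in> G r"
  by (auto simp: multivecs_def intro!: exI[of _ "[]"])

lemma multivecs_add: "X \<in> G r \<Longrightarrow> Y \<in> G r \<Longrightarrow> X + Y \<in> G r"
proof -
  assume "X \<in> G r" "Y \<in> G r"
  then obtain Xs Ys where "X = sum_list Xs" "Y = sum_list Ys"
    "set Xs \<subseteq> blades G0 G1 r" "set Ys \<subseteq> blades G0 G1 r"
    by (auto simp: multivecs_def)
  then show ?thesis by (auto simp: multivecs_def intro!: exI[of _ "Xs @ Ys"])
qed

lemma multivecs_scaled_prod_list:
  assumes "orthogonal_list vs" "c \<in> G0" "length vs = r"
  shows "c * prod_list vs \<in> G r"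
  using blades_scaled_prod_list[OF assms(1,2)] assms(3)
  by (auto simp: multivecs_def intro!: exI[of _ "[c * prod_list vs]"])

lemma multivecs_induct [consumes 1, case_names zero blade add]:
  assumes "X \<in> G r" "P 0"
    and blade: "\<And>c vs. c \<in> G0 \<Longrightarrow> orthogonal_list vs \<Longrightarrow> length vs = r \<Longrightarrow> P (c * prod_list vs)"
    and add: "\<And>X Y. P X \<Longrightarrow> P Y \<Longrightarrow> P (X + Y)"
  shows "P X"
proof -
  obtain Xs where "X = sum_list Xs" "set Xs \<subseteq> blades G0 G1 r"
    using assms(1) by (auto simp: multivecs_def)
  moreover have "P (sum_list Xs)" if "set Xs \<subseteq> blades G0 G1 r" for Xs
    using that
  proof (induction Xs)
    case (Cons Y Ys)
    then have "P Y" using bladesE[of Y r] blade by (metis list.set_intros(1) subsetD)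
    then show ?case using Cons add by simp
  qed (use assms in simp)
  ultimately show ?thesis by blast
qed

text \<open>The axioms let scalars commute with scalars and vectors; sums of products of these
  exhaust the ring by \<open>direct_sum\<close>.\<close>

lemma scalar_central: "c \<in> G0 \<Longrightarrow> c * X = X * c"
proof -
  assume c: "c \<in> G0"
  have pl: "c * prod_list vs = prod_list vs * c" if "set vs \<subseteq> G1" for vs
    using that
  proof (induction vs)
    case (Cons v vs)
    have "c * (v * prod_list vs) = v * (c * prod_list vs)"
      using vector_scale_commute[of c v] c Cons.prems by (simp flip: mult.assoc)
    then show ?case using Cons by (simp add: mult.assoc)
  qed simp
  have hom: "c * Y = Y * c" if "Y \<in> G r" for Y r
    using that
  proof (induction rule: multivecs_induct)
    case (blade d vs)
    have "c * (d * prod_list vs) = d * (c * prod_list vs)"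
      using scalar_commute[OF c blade(1)] by (simp flip: mult.assoc)
    then show ?case using pl[of vs] blade by (simp add: orthogonal_list_def mult.assoc)
  qed (auto simp: algebra_simps)
  obtain f where "is_grading G0 G1 X f" using direct_sum by blast
  then have f: "\<And>r. f r \<in> G r" "X = (\<Sum>r | f r \<noteq> 0. f r)" by (auto simp: is_grading_def)
  show ?thesis
    unfolding f(2) sum_distrib_left sum_distrib_right using hom f(1) by (intro sum.cong) auto
qed

lemma scalar_left_commute: "c \<in> G0 \<Longrightarrow> X * (c * Y) = c * (X * Y)"
  using scalar_central[of c X] by (simp flip: mult.assoc)

lemma multivecs_scale: "c \<in> G0 \<Longrightarrow> X \<in> G r \<Longrightarrow> c * X \<in> G r"
proof -
  assume c: "c \<in> G0" and X: "X \<in> G r"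
  from X show "c * X \<in> G r"
  proof (induction rule: multivecs_induct)
    case (blade d vs)
    then show ?case
      using multivecs_scaled_prod_list[of vs "c * d"] c by (simp add: scalar_mult mult.assoc)
  qed (auto simp: multivecs_zero multivecs_add distrib_left)
qed

lemma multivecs_uminus: "X \<in> G r \<Longrightarrow> - X \<in> G r"
  using multivecs_scale[of "-1" X r] scalar_one scalar_uminus by simp

lemma multivecs_vector: "v \<in> G1 \<Longrightarrow> v \<in> G (Suc 0)"
  using multivecs_scaled_prod_list[of "[v]" 1] scalar_one by (simp add: orthogonal_list_Cons)

section \<open>Moving a vector through an orthogonal product\<close>

lemma anticommute_prod_list:
  assumes "\<And>v. v \<in> set vs \<Longrightarrow> a * v + v * a = (0::'a)"
  shows "a * prod_list vs = (-1) ^ length vs * (prod_list vs * a)"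
  using assms
proof (induction vs)
  case (Cons v vs)
  have "a * v = - (v * a)" using Cons.prems[of v] by (simp add: eq_neg_iff_add_eq_0)
  then have "a * (v * prod_list vs) = - (v * (a * prod_list vs))"
    by (simp flip: mult.assoc)
  then show ?case using Cons
    by (cases "length vs" rule: neg_one_power_cases[where 'a='a]) (simp_all add: mult.assoc)
qed simp

text \<open>At the price of a sign, any factor of a blade may be taken to be the first one.\<close>

lemma orthogonal_list_move:
  assumes "orthogonal_list (xs @ v # ys)"
  shows "orthogonal_list (v # xs @ ys)"
    and "prod_list (xs @ v # ys) = (-1) ^ length xs * prod_list (v # xs @ ys)"
proof -
  have o: "v * u + u * v = 0" if "u \<in> set xs" for u
    using assms that by (auto simp: orthogonal_list_def sorted_wrt_append add.commute)
  then show "orthogonal_list (v # xs @ ys)"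
    using assms by (auto simp: orthogonal_list_def sorted_wrt_append)
  have "v * prod_list xs = (-1) ^ length xs * (prod_list xs * v)"
    using o by (rule anticommute_prod_list)
  then have "prod_list xs * v = (-1) ^ length xs * (v * prod_list xs)"
    by (cases "length xs" rule: neg_one_power_cases[where 'a='a]) simp_all
  then show "prod_list (xs @ v # ys) = (-1) ^ length xs * prod_list (v # xs @ ys)"
    by (simp flip: mult.assoc)
qed

text \<open>Splitting off the first factor \<open>v\<close> leaves
  \<open>(a * v + v * a) * W\<close> minus \<open>v\<close> times the same expression for the
  remaining product \<open>W\<close>. The terms are recorded as lists of factors taken from
  \<open>vs\<close>, because membership in a grade alone would not ensure that multiplying by
  \<open>v\<close> on the left gives blades again.\<close>

lemma commutator_multivec_list:
  assumes "a \<in> G1" "orthogonal_list vs" "vs \<noteq> []"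
  shows "\<exists>S. (\<forall>p\<in>set S. fst p \<in> G0 \<and> orthogonal_list (snd p) \<and> set (snd p) \<subseteq> set vs \<and>
            length (snd p) = length vs - 1) \<and>
          a * prod_list vs - (-1) ^ length vs * (prod_list vs * a)
            = (\<Sum>p\<leftarrow>S. fst p * prod_list (snd p))"
  using assms(2,3)
proof (induction vs)
  case (Cons v vs)
  let ?c = "a * v + v * a"
  have v: "v \<in> G1" and vs: "orthogonal_list vs"
    using Cons.prems by (auto simp: orthogonal_list_Cons)
  have c: "?c \<in> G0" using anticommutator_scalar assms v by blast
  show ?case
  proof (cases "vs = []")
    case True
    then show ?thesis using c
      by (intro exI[of _ "[(?c, [])]"]) simp
  next
    case False
    then obtain S where S: "\<forall>p\<in>set S. fst p \<in> G0 \<and> orthogonal_list (snd p) \<and>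
        set (snd p) \<subseteq> set vs \<and> length (snd p) = length vs - 1"
      "a * prod_list vs - (-1) ^ length vs * (prod_list vs * a)
            = (\<Sum>p\<leftarrow>S. fst p * prod_list (snd p))"
      using Cons.IH vs by blast
    define S' where "S' = (?c, vs) # map (\<lambda>(d, us). (- d, v # us)) S"
    have "a * prod_list (v # vs) - (-1) ^ length (v # vs) * (prod_list (v # vs) * a)
       = ?c * prod_list vs - v * (a * prod_list vs - (-1) ^ length vs * (prod_list vs * a))"
      by (cases "length vs" rule: neg_one_power_cases[where 'a='a]) (simp_all add: algebra_simps)
    also have "\<dots> = ?c * prod_list vs - v * (\<Sum>p\<leftarrow>S. fst p * prod_list (snd p))"
      by (simp only: S)
    also have "v * (\<Sum>p\<leftarrow>S. fst p * prod_list (snd p))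
        = (\<Sum>p\<leftarrow>S. fst p * (v * prod_list (snd p)))"
      unfolding sum_list_const_mult[symmetric]
      using S(1) by (intro arg_cong[of _ _ sum_list] map_cong) (auto simp: scalar_left_commute)
    finally have "a * prod_list (v # vs) - (-1) ^ length (v # vs) * (prod_list (v # vs) * a)
       = (\<Sum>p\<leftarrow>S'. fst p * prod_list (snd p))"
      by (simp add: S'_def case_prod_unfold o_def uminus_sum_list_map)
    moreover have "\<forall>p\<in>set S'. fst p \<in> G0 \<and> orthogonal_list (snd p) \<and>
        set (snd p) \<subseteq> set (v # vs) \<and> length (snd p) = length (v # vs) - 1"
      using S(1) c vs False Cons.prems
      by (fastforce simp: S'_def orthogonal_list_Cons scalar_uminus)
    ultimately show ?thesis by blast
  qed
qed simp

lemma lower_multivec_blade: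
  assumes "a \<in> G1" "orthogonal_list vs" "vs \<noteq> []"
  shows "a * prod_list vs - (-1) ^ length vs * (prod_list vs * a) \<in> G (length vs - 1)"
proof -
  obtain S where S: "\<forall>p\<in>set S. fst p \<in> G0 \<and> orthogonal_list (snd p) \<and>
        set (snd p) \<subseteq> set vs \<and> length (snd p) = length vs - 1"
      "a * prod_list vs - (-1) ^ length vs * (prod_list vs * a)
            = (\<Sum>p\<leftarrow>S. fst p * prod_list (snd p))"
    using commutator_multivec_list assms by blast
  have "(\<Sum>p\<leftarrow>S. fst p * prod_list (snd p)) \<in> G (length vs - 1)"
    using S(1) by (induction S) (auto simp: multivecs_zero intro!: multivecs_add multivecs_scaled_prod_list)
  then show ?thesis using S by simp
qed

text \<open>\<open>c\<close> is \<open>x / (2 d)\<close>. With \<open>x = a * v + v * a\<close> and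
  \<open>d = v * v\<close> it is the coefficient that makes \<open>a - c * v\<close> orthogonal to
  \<open>v\<close>.\<close>

lemma scalar_halve_divide:
  assumes "x \<in> G0" "d \<in> G0" "d \<noteq> 0"
  obtains c where "c \<in> G0" "c * d + c * d = x"
proof -
  obtain e where e: "e \<in> G0" "d * e = 1" using scalar_inverse assms by blast
  let ?c = "mult_inv 2 * (x * e)"
  have "e * d = 1" using e scalar_commute assms by metis
  then have "?c * d + ?c * d = mult_inv 2 * (x + x)"
    by (simp add: mult.assoc distrib_left)
  moreover have "?c \<in> G0" using e assms half_scalar by (simp add: scalar_mult)
  ultimately show ?thesis using that half_double by simp
qed

subsection \<open>Products of a vector and a blade\<close>

text \<open>Since \<open>v\<close> anticommutes with every \<open>u\<close>, it can be moved next to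
  each subtracted multiple of \<open>v\<close>, where \<open>v * v = 0\<close> removes that
  multiple.\<close>

lemma prod_list_shift_null:
  assumes "v * v = (0::'a)" "\<And>u. u \<in> set us \<Longrightarrow> v * u + u * v = 0"
    "\<And>u. u \<in> set us \<Longrightarrow> f u \<in> G0"
  shows "v * prod_list (map (\<lambda>u. u - f u * v) us) = v * prod_list us"
  using assms(2,3)
proof (induction us)
  case (Cons u us)
  let ?W = "prod_list (map (\<lambda>u. u - f u * v) us)"
  have vu: "v * u = - (u * v)" using Cons.prems(1)[of u] by (simp add: eq_neg_iff_add_eq_0)
  have "v * (f u * v) = 0"
    using scalar_left_commute[of "f u" v v] Cons.prems assms(1) by simp
  then have "v * (u - f u * v) = v * u" by (simp add: right_diff_distrib)
  then have "v * prod_list (map (\<lambda>u. u - f u * v) (u # us)) = - (u * (v * ?W))"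
    using vu by (simp flip: mult.assoc)
  also have "\<dots> = - (u * (v * prod_list us))" using Cons by simp
  also have "\<dots> = v * prod_list (u # us)" using vu by (simp flip: mult.assoc)
  finally show ?case .
qed simp

text \<open>
  If a vector \<open>a\<close> meets a null factor \<open>v\<close> of the blade, then \<open>a\<close> and \<open>v\<close> span a hyperbolic plane,
  and the remaining factors may be made orthogonal to that plane by subtracting multiples of \<open>v\<close>,
  which does not change the blade.
\<close>

lemma upper_multivec_null:
  assumes a: "a \<in> G1" and o: "orthogonal_list (v # us)"
    and null: "v * v = 0" and av: "a * v + v * a \<noteq> 0"
  shows "a * prod_list (v # us) + (-1) ^ length (v # us) * (prod_list (v # us) * a)
           \<in> G (Suc (length (v # us)))"
proof -
  have v: "v \<in> G1" and us: "set us \<subseteq> G1" "orthogonal_list us"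
    and vu: "\<And>u. u \<in> set us \<Longrightarrow> v * u + u * v = 0"
    using o by (auto simp: orthogonal_list_def)
  obtain e where e: "e \<in> G0" "(a * v + v * a) * e = 1"
    using scalar_inverse[OF anticommutator_scalar[OF a v] av] by blast
  have e': "e * (a * v + v * a) = 1" using e scalar_central by metis
  \<comment> \<open>With this coefficient \<open>a\<close> anticommutes with
    \<open>u - f u * v\<close>, as \<open>e\<close> inverts \<open>a * v + v * a\<close>.\<close>
  define f where "f u = (a * u + u * a) * e" for u
  have f: "f u \<in> G0" if "u \<in> set us" for u
    using that us a e(1) by (auto simp: f_def intro!: scalar_mult anticommutator_scalar)
  define ws where "ws = map (\<lambda>u. u - f u * v) us"
  have lc: "u * (f u' * w) = f u' * (u * w)" if "u' \<in> set us" for u u' w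
    using scalar_left_commute f that by blast
  have comm: "x * (u - f u * v) + (u - f u * v) * x
      = (x * u + u * x) - f u * (x * v + v * x)" if "u \<in> set us" for x u
    using lc[OF that] by (simp add: left_diff_distrib right_diff_distrib distrib_left mult.assoc)
  have vw: "v * w + w * v = 0" if "w \<in> set ws" for w
    using that comm[of _ v] vu null by (auto simp: ws_def)
  have aw: "a * w + w * a = 0" if "w \<in> set ws" for w
    using that comm[of _ a] e' by (auto simp: ws_def f_def mult.assoc)
  have wsG: "set ws \<subseteq> G1"
    using us v f by (auto simp: ws_def intro!: vector_diff vector_scale)
  \<comment> \<open>Orthogonality survives the change because \<open>v\<close> is null and
    orthogonal to all of \<open>us\<close>.\<close>
  have "sorted_wrt (\<lambda>u w. u * w + w * u = 0) ws"
    unfolding ws_def sorted_wrt_map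
  proof (rule sorted_wrt_mono_rel)
    show "sorted_wrt (\<lambda>u w. u * w + w * u = 0) us" using us by (simp add: orthogonal_list_def)
    fix u w assume uw: "u \<in> set us" "w \<in> set us" "u * w + w * u = 0"
    have "(u - f u * v) * v + v * (u - f u * v) = 0"
      using vw[of "u - f u * v"] uw(1) by (simp add: ws_def add.commute)
    moreover have "(u - f u * v) * w + w * (u - f u * v) = 0"
      using comm[OF uw(1), of w] uw(3) vu[OF uw(2)] by (simp add: add.commute)
    ultimately show "(u - f u * v) * (w - f w * v) + (w - f w * v) * (u - f u * v) = 0"
      using comm[OF uw(2), of "u - f u * v"] by simp
  qed
  then have ws: "orthogonal_list ws" using wsG by (simp add: orthogonal_list_def)
  have prod: "prod_list (v # us) = v * prod_list ws"
    using prod_list_shift_null[of v us f] null vu f by (simp add: ws_def)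
  have len: "length ws = length us" by (simp add: ws_def)
  have "a * prod_list ws = (-1) ^ length us * (prod_list ws * a)"
    using anticommute_prod_list[of ws a] aw len by simp
  then have "prod_list ws * a = (-1) ^ length us * (a * prod_list ws)"
    by (cases "length us" rule: neg_one_power_cases[where 'a='a]) simp_all
  \<comment> \<open>Since \<open>a\<close> passes \<open>ws\<close> with signs only, it remains to
    write \<open>a * v - v * a\<close> as twice a product of two orthogonal vectors that are
    orthogonal to \<open>ws\<close>.\<close>
  then have expr: "a * prod_list (v # us) + (-1) ^ length (v # us) * (prod_list (v # us) * a)
      = (a * v - v * a) * prod_list ws"
    unfolding prod
    by (cases "length us" rule: neg_one_power_cases[where 'a='a])
      (simp_all add: mult.assoc left_diff_distrib)
  \<comment> \<open>A null \<open>a\<close> is replaced by \<open>a + v\<close>, whose square is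
    \<open>a * v + v * a\<close>; adding \<open>v\<close> does not change the commutator with
    \<open>v\<close>.\<close>
  obtain b where b: "b \<in> G1" "b * b \<noteq> 0" "b * v - v * b = a * v - v * a"
      "\<And>w. w \<in> set ws \<Longrightarrow> b * w + w * b = 0"
  proof (cases "a * a = 0")
    case True
    have "(a + v) * (a + v) = a * v + v * a"
      using True null by (simp add: algebra_simps)
    moreover have "(a + v) * w + w * (a + v) = 0" if "w \<in> set ws" for w
    proof -
      have "(a + v) * w + w * (a + v) = (a * w + w * a) + (v * w + w * v)"
        by (simp add: algebra_simps)
      then show ?thesis using aw vw that by simp
    qed
    ultimately show ?thesis
      using that[of "a + v"] a v av null by (simp add: vector_add algebra_simps)
  next
    case False
    then show ?thesis using that[of a] a aw by blast
  qed
  \<comment> \<open>Gram-Schmidt against the non-null \<open>b\<close>: the vector \<open>w\<close>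
    below is \<open>v\<close> without its component along \<open>b\<close>. That component commutes
    with \<open>b\<close>, so \<open>b * v - v * b\<close> is twice \<open>b * w\<close>.\<close>
  obtain c where c: "c \<in> G0" "c * (b * b) + c * (b * b) = b * v + v * b"
    using scalar_halve_divide[of "b * v + v * b" "b * b"] anticommutator_scalar b v vector_square
    by blast
  define w where "w = v - c * b"
  have bcb: "b * (c * b) = c * (b * b)" using scalar_left_commute c by blast
  have bw: "b * w + w * b = 0"
    using c(2) by (simp add: w_def left_diff_distrib right_diff_distrib bcb mult.assoc
        algebra_simps)
  have "b * v - v * b = b * w - w * b"
    by (simp add: w_def left_diff_distrib right_diff_distrib bcb mult.assoc)
  also have "\<dots> = b * w + b * w" using bw by (simp add: eq_neg_iff_add_eq_0 diff_eq_eq)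
  finally have "a * v - v * a = b * w + b * w" using b by simp
  then have expr': "(a * v - v * a) * prod_list ws = prod_list (b # w # ws) + prod_list (b # w # ws)"
    by (simp add: distrib_right mult.assoc)
  have "w * x + x * w = 0" if "x \<in> set ws" for x
  proof -
    have "w * x + x * w = (v * x + x * v) - c * (b * x + x * b)"
      using scalar_left_commute[OF c(1), of x b]
      by (simp add: w_def left_diff_distrib right_diff_distrib distrib_left mult.assoc)
    then show ?thesis using vw b that by simp
  qed
  then have "orthogonal_list (b # w # ws)"
    using ws b bw c v by (auto simp: orthogonal_list_Cons w_def intro!: vector_diff vector_scale)
  then have "prod_list (b # w # ws) \<in> G (Suc (length (v # us)))"
    using multivecs_scaled_prod_list[of "b # w # ws" 1] scalar_one len by simp
  then show ?thesis unfolding expr expr' by (rule multivecs_add) fact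
qed

text \<open>With \<open>v\<close> moved to the front, the two terms cancel because \<open>v\<close>
  anticommutes with the remaining factors. Thus a blade has zero outer product with each of its
  factors, null ones included.\<close>

lemma prod_list_factor_commute:
  assumes "orthogonal_list vs" "v \<in> set vs"
  shows "v * prod_list vs + (-1) ^ length vs * (prod_list vs * v) = 0"
proof -
  obtain xs ys where vs: "vs = xs @ v # ys" using assms(2) by (metis split_list)
  define us where "us = xs @ ys"
  have o: "orthogonal_list (v # us)" and V: "prod_list vs = (-1) ^ length xs * prod_list (v # us)"
    using orthogonal_list_move[of xs v ys] assms(1) vs by (auto simp: us_def)
  have len: "length vs = Suc (length us)" by (simp add: vs us_def)
  have "v * prod_list us = (-1) ^ length us * (prod_list us * v)"
    using anticommute_prod_list o by (auto simp: orthogonal_list_Cons)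
  then have "v * (v * prod_list us) = (-1) ^ length us * (v * (prod_list us * v))"
    by (cases "length us" rule: neg_one_power_cases[where 'a='a]) simp_all
  then show ?thesis
    unfolding V len
    by (cases "length xs" rule: neg_one_power_cases[where 'a='a];
        cases "length us" rule: neg_one_power_cases[where 'a='a]) (simp_all add: mult.assoc)
qed

text \<open>Induction on the number of factors not orthogonal to \<open>a\<close>. If there are
  none, both terms equal the blade \<open>a * prod_list vs\<close>. If such a factor is not null, a
  multiple of it is subtracted from \<open>a\<close> to reach orthogonality; if it is null,
  \<open>upper_multivec_null\<close> applies.\<close>

lemma upper_multivec_blade:
  assumes "a \<in> G1" "orthogonal_list vs"
  shows "a * prod_list vs + (-1) ^ length vs * (prod_list vs * a) \<in> G (Suc (length vs))"
  using assms
proof (induction "length (filter (\<lambda>v. a * v + v * a \<noteq> 0) vs)" arbitrary: a vs rule: less_induct)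
  case less
  show ?case
  proof (cases "\<forall>v\<in>set vs. a * v + v * a = 0")
    case True
    then have "(-1) ^ length vs * (prod_list vs * a) = prod_list (a # vs)"
      using anticommute_prod_list[of vs a] by simp
    moreover have "prod_list (a # vs) \<in> G (Suc (length vs))"
      using multivecs_scaled_prod_list[of "a # vs" 1] less.prems True scalar_one
      by (simp add: orthogonal_list_Cons)
    ultimately show ?thesis using multivecs_add by simp
  next
    case False
    then obtain v xs ys where vs: "vs = xs @ v # ys" and av: "a * v + v * a \<noteq> 0"
      by (metis split_list)
    define us where "us = xs @ ys"
    have ous: "orthogonal_list (v # us)"
      and prod: "prod_list vs = (-1) ^ length xs * prod_list (v # us)"
      using orthogonal_list_move[of xs v ys] less.prems vs by (auto simp: us_def)
    have v: "v \<in> G1" and vu: "\<And>u. u \<in> set us \<Longrightarrow> v * u + u * v = 0"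
      using ous by (auto simp: orthogonal_list_Cons)
    have len: "length vs = length (v # us)" by (simp add: vs us_def)
    have "a * prod_list (v # us) + (-1) ^ length (v # us) * (prod_list (v # us) * a)
        \<in> G (Suc (length (v # us)))"
    proof (cases "v * v = 0")
      case True
      then show ?thesis using upper_multivec_null less.prems ous av by blast
    next
      case False
      obtain c where c: "c \<in> G0" "c * (v * v) + c * (v * v) = a * v + v * a"
        using scalar_halve_divide[of "a * v + v * a" "v * v"] False anticommutator_scalar
          less.prems v vector_square by blast
      define b where "b = a - c * v"
      have bx: "b * x + x * b = (a * x + x * a) - c * (v * x + x * v)" for x
        using scalar_left_commute[OF c(1), of x v]
        by (simp add: b_def left_diff_distrib right_diff_distrib distrib_left mult.assoc)
      have "b * v + v * b = 0" using bx[of v] c(2) by (simp add: distrib_left)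
      moreover have "b * u + u * b = a * u + u * a" if "u \<in> set us" for u
        using bx[of u] vu that by simp
      \<comment> \<open>The vector \<open>b\<close> pairs with \<open>us\<close> as \<open>a\<close>
        does and is orthogonal to \<open>v\<close>, so exactly this occurrence of \<open>v\<close>
        leaves the count.\<close>
      ultimately have "length (filter (\<lambda>v. b * v + v * b \<noteq> 0) (v # us))
          < length (filter (\<lambda>v. a * v + v * a \<noteq> 0) vs)"
        using av by (auto simp: vs us_def cong: filter_cong)
      moreover have "b \<in> G1" using less.prems c v by (simp add: b_def vector_diff vector_scale)
      ultimately have IH: "b * prod_list (v # us) + (-1) ^ length (v # us) * (prod_list (v # us) * b)
          \<in> G (Suc (length (v # us)))"
        using less.hyps ous by blast
      \<comment> \<open>The part \<open>c * v\<close> of \<open>a\<close> contributes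
        nothing.\<close>
      have z: "v * prod_list (v # us) + (-1) ^ length (v # us) * (prod_list (v # us) * v) = 0"
        using prod_list_factor_commute[OF ous, of v] by simp
      let ?V = "prod_list (v # us)"
      have "a * ?V + (-1) ^ length (v # us) * (?V * a)
          = b * ?V + (-1) ^ length (v # us) * (?V * b)
            + c * (v * ?V + (-1) ^ length (v # us) * (?V * v))"
        using scalar_left_commute[OF c(1), of ?V v]
        by (cases "length (v # us)" rule: neg_one_power_cases[where 'a='a])
          (simp_all only: b_def left_diff_distrib right_diff_distrib distrib_left mult.assoc, simp_all)
      then show ?thesis using IH z by simp
    qed
    then show ?thesis
      unfolding prod len
      by (cases "length xs" rule: neg_one_power_cases[where 'a='a])
        (use multivecs_uminus in \<open>fastforce+\<close>)
  qed
qed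

lemma multivecs_zero_commute:
  assumes "X \<in> G 0" shows "a * X = X * a"
  using assms
proof (induction rule: multivecs_induct)
  case (blade c vs)
  then show ?case using scalar_central[of c a] by simp
qed (simp_all add: algebra_simps)

lemma upper_multivec:
  assumes "a \<in> G1" "X \<in> G k"
  shows "a * X + (-1) ^ k * (X * a) \<in> G (Suc k)"
  using assms(2)
proof (induction rule: multivecs_induct)
  case (blade c vs)
  have "a * (c * prod_list vs) + (-1) ^ k * (c * prod_list vs * a)
      = c * (a * prod_list vs + (-1) ^ length vs * (prod_list vs * a))"
    using scalar_left_commute[OF blade(1), of a "prod_list vs"] blade(3)
    by (cases k rule: neg_one_power_cases[where 'a='a]) (simp_all add: algebra_simps)
  then show ?case using multivecs_scale[OF blade(1) upper_multivec_blade[OF assms(1) blade(2)]] blade(3)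
    by simp
next
  case (add X Y)
  then show ?case using multivecs_add[OF add] by (simp add: algebra_simps)
qed (simp add: multivecs_zero)

text \<open>The grade is a successor because a vector commutes with elements of grade 0: there the
  difference is 0 and no lower grade exists.\<close>

lemma lower_multivec:
  assumes "a \<in> G1" "X \<in> G (Suc k)"
  shows "a * X - (-1) ^ Suc k * (X * a) \<in> G k"
  using assms(2)
proof (induction rule: multivecs_induct)
  case (blade c vs)
  have "a * (c * prod_list vs) - (-1) ^ Suc k * (c * prod_list vs * a)
      = c * (a * prod_list vs - (-1) ^ length vs * (prod_list vs * a))"
    using scalar_left_commute[OF blade(1), of a "prod_list vs"] blade(3)
    by (cases k rule: neg_one_power_cases[where 'a='a]) (simp_all add: algebra_simps)
  moreover have "vs \<noteq> []" using blade by auto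
  ultimately show ?case
    using multivecs_scale[OF blade(1) lower_multivec_blade[OF assms(1) blade(2)]] blade(3) by simp
next
  case (add X Y)
  then show ?case using multivecs_add[OF add] by (simp add: algebra_simps)
qed (simp add: multivecs_zero)

subsection \<open>Homogeneous components\<close>

lemma component_is_grading: "is_grading G0 G1 X (cmp X)"
  unfolding component_def using direct_sum by (rule theI')

lemma component_multivecs: "cmp X r \<in> G r"
  and component_finite: "finite {r. cmp X r \<noteq> 0}"
  and component_sum: "X = (\<Sum>r | cmp X r \<noteq> 0. cmp X r)"
  using component_is_grading[of X] by (auto simp: is_grading_def)

text \<open>\<open>S\<close> may exceed the support of \<open>f\<close>, so that several elements
  can be summed over one common finite set.\<close>

lemma component_eqI:
  assumes "finite S" "\<And>r. r \<notin> S \<Longrightarrow> f r = 0" "\<And>r. f r \<in> G r" "X = sum f S"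
  shows "cmp X = f"
proof -
  have "{r. f r \<noteq> 0} \<subseteq> S" using assms by auto
  then have "finite {r. f r \<noteq> 0}" "sum f S = (\<Sum>r | f r \<noteq> 0. f r)"
    using assms(1) by (auto intro: finite_subset sum.mono_neutral_right)
  then have "is_grading G0 G1 X f" using assms by (auto simp: is_grading_def)
  then show ?thesis unfolding component_def using direct_sum by (intro the1_equality)
qed

lemma component_sum_superset:
  assumes "finite S" "{r. cmp X r \<noteq> 0} \<subseteq> S"
  shows "X = sum (cmp X) S"
proof -
  have "sum (cmp X) S = (\<Sum>r | cmp X r \<noteq> 0. cmp X r)"
    using assms by (intro sum.mono_neutral_right) auto
  then show ?thesis using component_sum by simp
qed

lemma component_add: "cmp (X + Y) r = cmp X r + cmp Y r"
proof -
  let ?S = "{r. cmp X r \<noteq> 0} \<union> {r. cmp Y r \<noteq> 0}"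
  have fin: "finite ?S" using component_finite by simp
  have "X + Y = (\<Sum>r\<in>?S. cmp X r + cmp Y r)"
    using component_sum_superset[OF fin, of X] component_sum_superset[OF fin, of Y]
    by (simp add: sum.distrib)
  then have "cmp (X + Y) = (\<lambda>r. cmp X r + cmp Y r)"
    using fin by (intro component_eqI[of ?S]) (auto simp: component_multivecs multivecs_add)
  then show ?thesis by simp
qed

lemma component_multivec:
  assumes "X \<in> G k"
  shows "cmp X r = (if r = k then X else 0)"
proof -
  have "cmp X = (\<lambda>r. if r = k then X else 0)"
    using assms by (intro component_eqI[of "{k}"]) (auto simp: multivecs_zero)
  then show ?thesis by simp
qed

lemma component_zero [simp]: "cmp 0 r = 0"
  using component_multivec[OF multivecs_zero, of r r] by simp

lemma component_uminus: "cmp (- X) r = - cmp X r"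
  using component_add[of X "- X" r] by (simp add: eq_neg_iff_add_eq_0 add.commute)

lemma component_diff: "cmp (X - Y) r = cmp X r - cmp Y r"
  using component_add[of X "- Y" r] by (simp add: component_uminus)

section \<open>Bounds on the grades that occur\<close>

text \<open>Integer bounds keep differences such as \<open>int s - int r\<close> free of truncation;
  a negative lower bound excludes nothing.\<close>

definition grades_within :: "int \<Rightarrow> int \<Rightarrow> 'a \<Rightarrow> bool" where
  "grades_within l u X \<longleftrightarrow> (\<forall>n. cmp X n \<noteq> 0 \<longrightarrow> l \<le> int n \<and> int n \<le> u)"

lemma grades_within_zero [simp]: "grades_within l u 0"
  by (simp add: grades_within_def)

lemma grades_within_add:
  "grades_within l u X \<Longrightarrow> grades_within l u Y \<Longrightarrow> grades_within l u (X + Y)"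
  unfolding grades_within_def component_add by (metis add.right_neutral)

lemma grades_within_sum:
  "(\<And>i. i \<in> I \<Longrightarrow> grades_within l u (f i)) \<Longrightarrow> grades_within l u (sum f I)"
  by (induction I rule: infinite_finite_induct) (auto intro: grades_within_add)

lemma grades_within_multivec: "X \<in> G k \<Longrightarrow> grades_within (int k) (int k) X"
  by (simp add: grades_within_def component_multivec)

lemma vector_mult_split:
  "a * X = mult_inv 2 * (a * X + (-1) ^ k * (X * a))
         + mult_inv 2 * (a * X - (-1) ^ k * (X * (a::'a)))"
proof -
  have "mult_inv 2 * (a * X + (-1) ^ k * (X * a)) + mult_inv 2 * (a * X - (-1) ^ k * (X * a))
      = mult_inv 2 * (a * X + a * X)"
    by (simp flip: distrib_left)
  then show ?thesis by (simp add: half_double)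
qed

text \<open>The two summands of \<open>vector_mult_split\<close> are homogeneous of grades
  \<open>k + 1\<close> and \<open>k - 1\<close>. The condition \<open>Suc n = k\<close> never holds
  for \<open>k = 0\<close>, where the lower summand is 0.\<close>

lemma component_vector_mult:
  assumes "a \<in> G1" "X \<in> G k"
  shows "cmp (a * X) n =
    (if n = Suc k then mult_inv 2 * (a * X + (-1) ^ k * (X * a))
     else if Suc n = k then mult_inv 2 * (a * X - (-1) ^ k * (X * a)) else 0)"
proof -
  let ?U = "mult_inv 2 * (a * X + (-1) ^ k * (X * a))"
  let ?D = "mult_inv 2 * (a * X - (-1) ^ k * (X * a))"
  have "?U \<in> G (Suc k)" using upper_multivec assms by (simp add: multivecs_scale half_scalar)
  moreover have "cmp ?D n = (if Suc n = k then ?D else 0)"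
  proof (cases k)
    case 0
    then have "?D = 0" using multivecs_zero_commute assms(2) by simp
    then show ?thesis by simp
  next
    case (Suc j)
    then have "?D \<in> G j"
      using lower_multivec[of a X j] assms by (simp add: multivecs_scale half_scalar)
    then show ?thesis using Suc by (simp add: component_multivec)
  qed
  moreover have "cmp (a * X) n = cmp ?U n + cmp ?D n"
    by (subst vector_mult_split[of a X k]) (simp add: component_add)
  ultimately show ?thesis by (auto simp: component_multivec)
qed

lemma grades_within_vector_mult:
  assumes "a \<in> G1" "grades_within l u X"
  shows "grades_within (l - 1) (u + 1) (a * X)"
proof -
  have "grades_within (l - 1) (u + 1) (a * cmp X r)" if "cmp X r \<noteq> 0" for r
    using that assms(2) component_vector_mult[OF assms(1) component_multivecs[of X r]]
    by (force simp: grades_within_def)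
  then have "grades_within (l - 1) (u + 1) (\<Sum>r | cmp X r \<noteq> 0. a * cmp X r)"
    by (intro grades_within_sum) simp
  then show ?thesis using component_sum[of X] by (simp flip: sum_distrib_left)
qed

text \<open>Each vector factor widens the interval by one at both ends.\<close>

lemma grades_within_prod_list_mult:
  assumes "set vs \<subseteq> G1" "grades_within l u X"
  shows "grades_within (l - int (length vs)) (u + int (length vs)) (prod_list vs * X)"
  using assms(1)
proof (induction vs)
  case (Cons v vs)
  then show ?case
    using grades_within_vector_mult[of v "l - int (length vs)" "u + int (length vs)" "prod_list vs * X"]
    by (simp add: mult.assoc algebra_simps)
qed (simp add: assms)

lemma component_scale: "c \<in> G0 \<Longrightarrow> cmp (c * X) r = c * cmp X r"
proof -
  assume c: "c \<in> G0"
  have "cmp (c * X) = (\<lambda>r. c * cmp X r)"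
  proof (rule component_eqI)
    show "finite {r. cmp X r \<noteq> 0}" by (rule component_finite)
    show "c * X = (\<Sum>r | cmp X r \<noteq> 0. c * cmp X r)"
      by (subst component_sum[of X]) (simp add: sum_distrib_left)
  qed (auto simp: multivecs_scale component_multivecs c)
  then show ?thesis by simp
qed

lemma grades_within_multivec_mult:
  assumes "B \<in> G s" "grades_within l u X"
  shows "grades_within (l - int s) (u + int s) (B * X)"
  using assms(1)
proof (induction rule: multivecs_induct)
  case (blade c vs)
  have "grades_within (l - int s) (u + int s) (prod_list vs * X)"
    using grades_within_prod_list_mult[of vs l u X] blade assms(2) by (auto simp: orthogonal_list_def)
  then show ?case
    using component_scale[OF blade(1)] by (force simp: grades_within_def mult.assoc)
qed (auto simp: distrib_right intro: grades_within_add)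

lemma grade_part_add: "gp (X + Y) k = gp X k + gp Y k"
  by (simp add: grade_part_def component_add)

lemma grade_part_outside: "grades_within l u X \<Longrightarrow> k < l \<or> u < k \<Longrightarrow> gp X k = 0"
  by (auto simp: grade_part_def grades_within_def) (metis int_nat_eq not_le)+

lemma grade_part_in: "gp X k \<in> G (nat k)"
  by (simp add: grade_part_def component_multivecs multivecs_zero)

lemma grades_within_mult:
  assumes "X \<in> G r" "Y \<in> G s"
  shows "grades_within (int s - int r) (int s + int r) (X * Y)"
  using grades_within_multivec_mult[OF assms(1) grades_within_multivec[OF assms(2)]] .

lemma component_grade_part: "cmp (gp X k) n = (if int n = k then cmp X n else 0)"
  using component_multivec[OF component_multivecs[of X "nat k"], of n]
  by (auto simp: grade_part_def)

lemma grades_within_diff_top: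
  "grades_within l u X \<Longrightarrow> grades_within l (u - 1) (X - gp X u)"
  by (force simp: grades_within_def component_diff component_grade_part split: if_splits)

lemma grades_within_diff_bottom:
  "grades_within l u X \<Longrightarrow> grades_within (l + 1) u (X - gp X l)"
  by (force simp: grades_within_def component_diff component_grade_part split: if_splits)

subsection \<open>Outer product and contraction\<close>

text \<open>For nonzero homogeneous arguments both index sets are singletons; the index set of 0 is
  empty, hence the case distinction.\<close>

lemma wedge_multivecs:
  assumes "X \<in> G r" "Y \<in> G s"
  shows "wedge G0 G1 X Y = gp (X * Y) (int r + int s)"
proof (cases "X = 0 \<or> Y = 0")
  case True
  then show ?thesis by (auto simp: wedge_def grade_part_def)
next
  case False
  then have "{i. cmp X i \<noteq> 0} = {r}" "{i. cmp Y i \<noteq> 0} = {s}"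
    using assms by (auto simp: component_multivec)
  then show ?thesis using assms by (simp add: wedge_def component_multivec)
qed

lemma contraction_multivecs:
  assumes "X \<in> G r" "Y \<in> G s"
  shows "contraction G0 G1 X Y = gp (X * Y) (int s - int r)"
proof (cases "X = 0 \<or> Y = 0")
  case True
  then show ?thesis by (auto simp: contraction_def grade_part_def)
next
  case False
  then have "{i. cmp X i \<noteq> 0} = {r}" "{i. cmp Y i \<noteq> 0} = {s}"
    using assms by (auto simp: component_multivec)
  then show ?thesis using assms by (simp add: contraction_def component_multivec)
qed

lemma wedge_in:
  assumes "X \<in> G r" "Y \<in> G s"
  shows "wedge G0 G1 X Y \<in> G (r + s)"
  using grade_part_in[of "X * Y" "int r + int s"] wedge_multivecs[OF assms] by (simp add: nat_add_distrib)

lemma wedge_vector: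
  assumes "a \<in> G1" "X \<in> G k"
  shows "wedge G0 G1 a X = mult_inv 2 * (a * X + (-1) ^ k * (X * a))"
proof -
  have "wedge G0 G1 a X = gp (a * X) (1 + int k)"
    using wedge_multivecs[OF multivecs_vector assms(2)] assms by simp
  then show ?thesis by (simp add: grade_part_def component_vector_mult[OF assms] nat_add_distrib)
qed

lemma contraction_vector:
  assumes "a \<in> G1" "X \<in> G k"
  shows "contraction G0 G1 a X = mult_inv 2 * (a * X - (-1) ^ k * (X * a))"
proof -
  have eq: "contraction G0 G1 a X = gp (a * X) (int k - 1)"
    using contraction_multivecs[OF multivecs_vector assms(2)] assms by simp
  show ?thesis
  proof (cases k)
    \<comment> \<open>The grade in question is -1, so the contraction is 0 by convention, and
      \<open>a\<close> commutes with \<open>X\<close>.\<close>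
    case 0
    then show ?thesis
      using eq multivecs_zero_commute[of X a] assms(2) by (simp add: grade_part_def)
  next
    case (Suc j)
    then show ?thesis using eq by (simp add: grade_part_def component_vector_mult[OF assms])
  qed
qed

text \<open>The difference is the contraction of \<open>B\<close> by \<open>a\<close>. It has grade
  \<open>s - 1\<close> (and is 0 for \<open>s = 0\<close>), so its product with \<open>A\<close>
  misses the grades \<open>r + s + 1\<close> and \<open>r - s - 1\<close>.\<close>

lemma wedge_diff_within:
  assumes "a \<in> G1" "B \<in> G s" "A \<in> G r"
  shows "grades_within (int r - int s + 1) (int r + int s - 1) ((a * B - wedge G0 G1 a B) * A)"
proof -
  let ?D = "mult_inv 2 * (a * B - (-1) ^ s * (B * a))"
  have D: "a * B - wedge G0 G1 a B = ?D"
    using vector_mult_split[of a B s] wedge_vector[OF assms(1,2)] by (simp add: diff_eq_eq add.commute)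
  show ?thesis
  proof (cases s)
    case 0
    then show ?thesis using multivecs_zero_commute[of B a] assms D by simp
  next
    case (Suc j)
    then have "?D \<in> G j"
      using lower_multivec[of a B j] assms by (simp add: multivecs_scale half_scalar)
    then have "grades_within (int r - int j) (int r + int j) (?D * A)"
      using assms(3) by (rule grades_within_mult)
    moreover have "int r - int s + 1 = int r - int j" "int r + int s - 1 = int r + int j"
      using Suc by simp_all
    ultimately show ?thesis unfolding D by (simp only:)
  qed
qed

text \<open>Both sides are the part of \<open>a * B * A\<close> of grade \<open>r + s + 1\<close>:
  within \<open>a * B\<close> only the outer product, and within \<open>B * A\<close> only the top
  part, can reach it.\<close>

lemma wedge_wedge_vector:
  assumes "a \<in> G1" "B \<in> G s" "A \<in> G r"
  shows "wedge G0 G1 (wedge G0 G1 a B) A = wedge G0 G1 a (wedge G0 G1 B A)"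
proof -
  let ?n = "int s + int r + 1"
  let ?Y = "gp (B * A) (int r + int s)"
  have Y: "wedge G0 G1 B A = ?Y" "?Y \<in> G (s + r)"
    using wedge_multivecs[OF assms(2,3)] wedge_in[OF assms(2,3)] by (simp_all add: add.commute)
  have aB: "wedge G0 G1 a B \<in> G (Suc s)"
    using wedge_in[OF multivecs_vector[OF assms(1)] assms(2)] by simp
  have "gp ((a * B - wedge G0 G1 a B) * A) ?n = 0"
    using wedge_diff_within[OF assms] by (rule grade_part_outside) simp
  then have L: "gp (a * B * A) ?n = gp (wedge G0 G1 a B * A) ?n"
    using grade_part_add[of "(a * B - wedge G0 G1 a B) * A" "wedge G0 G1 a B * A" ?n]
    by (simp add: left_diff_distrib)
  have "grades_within (int r - int s - 1) (int r + int s) (a * (B * A - ?Y))"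
    using grades_within_vector_mult[OF assms(1) grades_within_diff_top[OF grades_within_mult[OF assms(2,3)]]]
    by simp
  then have "gp (a * (B * A - ?Y)) ?n = 0"
    by (rule grade_part_outside) simp
  then have "gp (a * B * A) ?n = gp (a * ?Y) ?n"
    using grade_part_add[of "a * (B * A - ?Y)" "a * ?Y" ?n] by (simp add: right_diff_distrib mult.assoc)
  then show ?thesis
    using L wedge_multivecs[OF aB assms(3)] wedge_multivecs[OF multivecs_vector[OF assms(1)] Y(2)] Y(1)
    by (simp add: algebra_simps)
qed

text \<open>The dual comparison in the lowest grade \<open>r - s - 1\<close>, reached only from the
  outer product in \<open>a * B\<close> and from the bottom part of \<open>B * A\<close>.\<close>

lemma contraction_wedge_vector:
  assumes "a \<in> G1" "B \<in> G s" "A \<in> G r"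
  shows "contraction G0 G1 (wedge G0 G1 a B) A = contraction G0 G1 a (contraction G0 G1 B A)"
proof -
  let ?n = "int r - int s - 1"
  let ?Y = "gp (B * A) (int r - int s)"
  have Y: "contraction G0 G1 B A = ?Y"
    using contraction_multivecs[OF assms(2,3)] by simp
  have aB: "wedge G0 G1 a B \<in> G (Suc s)"
    using wedge_in[OF multivecs_vector[OF assms(1)] assms(2)] by simp
  have "gp ((a * B - wedge G0 G1 a B) * A) ?n = 0"
    using wedge_diff_within[OF assms] by (rule grade_part_outside) simp
  then have L: "gp (a * B * A) ?n = gp (wedge G0 G1 a B * A) ?n"
    using grade_part_add[of "(a * B - wedge G0 G1 a B) * A" "wedge G0 G1 a B * A" ?n]
    by (simp add: left_diff_distrib)
  have "grades_within (int r - int s) (int r + int s + 1) (a * (B * A - ?Y))"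
    using grades_within_vector_mult[OF assms(1) grades_within_diff_bottom[OF grades_within_mult[OF assms(2,3)]]]
    by simp
  then have "gp (a * (B * A - ?Y)) ?n = 0"
    by (rule grade_part_outside) simp
  then have "gp (a * B * A) ?n = gp (a * ?Y) ?n"
    using grade_part_add[of "a * (B * A - ?Y)" "a * ?Y" ?n] by (simp add: right_diff_distrib mult.assoc)
  moreover have "gp (a * ?Y) ?n = contraction G0 G1 a ?Y"
  \<comment> \<open>For \<open>s > r\<close> the grade of \<open>?Y\<close> would be negative, so
    \<open>?Y\<close> is 0 by convention and both sides vanish.\<close>
  proof (cases "s \<le> r")
    case True
    then have "?Y \<in> G (r - s)" using grade_part_in[of "B * A" "int r - int s"] by (simp add: nat_diff_distrib)
    from contraction_multivecs[OF multivecs_vector[OF assms(1)] this] True show ?thesis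
      by (simp add: of_nat_diff)
  next
    case False
    then show ?thesis by (simp add: grade_part_def contraction_def)
  qed
  ultimately show ?thesis
    using L contraction_multivecs[OF aB assms(3)] Y by (simp add: algebra_simps)
qed

text \<open>The exponent \<open>r + s\<close> has the parity of \<open>r - s\<close> without
  truncation. It also gives this formula and \<open>wedge_wedge_vector_formula\<close> one common
  shape up to a sign, as \<open>wedge_list_map_mult\<close> requires.\<close>

lemma contraction_wedge_vector_formula:
  assumes "a \<in> G1" "B \<in> G s" "A \<in> G r"
  shows "contraction G0 G1 (wedge G0 G1 a B) A = mult_inv 2 *
    (a * contraction G0 G1 B A - (-1) ^ (r + s) * (contraction G0 G1 B A * a))"
proof -
  let ?Y = "gp (B * A) (int r - int s)"
  have Y: "contraction G0 G1 B A = ?Y"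
    using contraction_multivecs[OF assms(2,3)] by simp
  have "contraction G0 G1 a ?Y = mult_inv 2 * (a * ?Y - (-1) ^ (r + s) * (?Y * a))"
  proof (cases "s \<le> r")
    case True
    then have "?Y \<in> G (r - s)" using grade_part_in[of "B * A" "int r - int s"] by (simp add: nat_diff_distrib)
    moreover have "(-1) ^ (r - s) = ((-1) ^ (r + s) :: 'a)"
      using True by (simp add: minus_one_power_iff)
    ultimately show ?thesis using contraction_vector[OF assms(1), of ?Y "r - s"] by simp
  next
    case False
    then show ?thesis by (simp add: grade_part_def contraction_def)
  qed
  then show ?thesis using contraction_wedge_vector[OF assms] Y by simp
qed

lemma wedge_wedge_vector_formula:
  assumes "a \<in> G1" "B \<in> G s" "A \<in> G r"
  shows "wedge G0 G1 (wedge G0 G1 a B) A = mult_inv 2 *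
    (a * wedge G0 G1 B A + (-1) ^ (r + s) * (wedge G0 G1 B A * a))"
  using wedge_wedge_vector[OF assms] wedge_vector[OF assms(1) wedge_in[OF assms(2,3)]]
  by (simp add: add.commute)

subsection \<open>Projection and rejection\<close>

text \<open>A null factor \<open>v\<close>, moved to the front, annihilates the blade from the left.
  Multiplying by the inverse gives \<open>v = 0\<close>, so the blade itself would be 0.\<close>

lemma invertible_blade_factor_square:
  assumes "orthogonal_list vs" "c \<in> G0" "mult_invertible (c * prod_list vs)" "v \<in> set vs"
  shows "v * v \<noteq> 0"
proof
  assume null: "v * v = 0"
  obtain xs ys where vs: "vs = xs @ v # ys" using assms(4) by (metis split_list)
  obtain B where B: "c * prod_list vs * B = 1" using assms(3) by (auto simp: mult_invertible_def)
  have "prod_list vs = (-1) ^ length xs * (v * prod_list (xs @ ys))"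
    using orthogonal_list_move(2)[of xs v ys] assms(1) vs by simp
  moreover have "v * (v * w) = 0" for w using null by (simp flip: mult.assoc)
  ultimately have "v * prod_list vs = 0"
    by (cases "length xs" rule: neg_one_power_cases[where 'a='a]) simp_all
  then have "v * (c * prod_list vs * B) = 0"
    using scalar_left_commute[OF assms(2), of v "prod_list vs * B"]
    by (simp add: mult.assoc) (simp flip: mult.assoc)
  then have "v = 0" using B by simp
  then have "prod_list vs = 0" using assms(4) by (simp add: prod_list_zero_iff[symmetric] vs)
  then show False using B by simp
qed

text \<open>Gram-Schmidt along non-null orthogonal vectors. An arbitrary subspace \<open>K\<close>
  containing them takes the place of their span.\<close>

lemma orthogonal_decomposition:
  assumes a: "a \<in> G1" and us: "orthogonal_list us" "\<And>u. u \<in> set us \<Longrightarrow> u * u \<noteq> 0"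
    and K: "set us \<subseteq> K" "0 \<in> K" "\<And>p q. p \<in> K \<Longrightarrow> q \<in> K \<Longrightarrow> p + q \<in> K"
      "\<And>c p. c \<in> G0 \<Longrightarrow> p \<in> K \<Longrightarrow> c * p \<in> K" "K \<subseteq> G1"
  shows "\<exists>p\<in>K. \<forall>u\<in>set us. (a - p) * u + u * (a - p) = 0"
  using us K(1)
proof (induction us)
  case (Cons v us)
  then obtain p where p: "p \<in> K" "\<And>u. u \<in> set us \<Longrightarrow> (a - p) * u + u * (a - p) = 0"
    by (auto simp: orthogonal_list_Cons)
  have v: "v \<in> G1" "v \<in> K" "v * v \<noteq> 0" "\<And>u. u \<in> set us \<Longrightarrow> v * u + u * v = 0"
    using Cons.prems by (auto simp: orthogonal_list_Cons)
  obtain c where c: "c \<in> G0" "c * (v * v) + c * (v * v) = (a - p) * v + v * (a - p)"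
    using scalar_halve_divide[of "(a - p) * v + v * (a - p)" "v * v"] v p K(5) a
    by (metis anticommutator_scalar subsetD vector_diff vector_square)
  have *: "(a - (p + c * v)) * u + u * (a - (p + c * v))
      = ((a - p) * u + u * (a - p)) - c * (v * u + u * v)" for u
    using scalar_left_commute[OF c(1), of u v] by (simp add: algebra_simps)
  have "p + c * v \<in> K" using p v c K by simp
  moreover have "(a - (p + c * v)) * u + u * (a - (p + c * v)) = 0" if "u \<in> set (v # us)" for u
  proof (cases "u = v")
    case True
    then show ?thesis unfolding * using c(2) by (simp add: distrib_left)
  next
    case False
    then show ?thesis unfolding * using that p(2) v(4) by simp
  qed
  ultimately show ?case by blast
qed (use K in auto)

lemma blades_subset_multivecs: "A \<in> blades G0 G1 r \<Longrightarrow> A \<in> G r"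
  by (auto simp: multivecs_def intro!: exI[of _ "[A]"])

text \<open>\<open>p\<close> is the component of \<open>a\<close> along the factors of
  \<open>A\<close>, and \<open>q\<close> anticommutes with every factor. The two sign rules turn
  \<open>a * A\<close> minus or plus \<open>(-1) ^ r * (A * a)\<close> into twice
  \<open>p * A\<close> or twice \<open>q * A\<close>.\<close>

lemma projection_rejection_split:
  assumes "A \<in> blades G0 G1 r" "mult_invertible A" "a \<in> G1"
  obtains p q where "p \<in> G1" "q \<in> G1" "a = p + q"
    "p * A = - ((-1) ^ r * (A * p))" "q * A = (-1) ^ r * (A * q)"
    "projection G0 G1 A a = p" "rejection G0 G1 A a = q"
proof -
  obtain c vs where vs: "c \<in> G0" "orthogonal_list vs" "length vs = r" "A = c * prod_list vs"
    using bladesE[OF assms(1)] by blast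
  have xA: "x * A = c * (x * prod_list vs)" for x
    using scalar_left_commute[OF vs(1)] vs(4) by simp
  \<comment> \<open>The relation is linear in \<open>p\<close> and holds for each factor of
    \<open>A\<close>, hence on their whole span.\<close>
  define K where "K = {p \<in> G1. p * A = - ((-1) ^ r * (A * p))}"
  have "v \<in> K" if "v \<in> set vs" for v
  proof -
    have "v * prod_list vs = - ((-1) ^ r * (prod_list vs * v))"
      using prod_list_factor_commute[OF vs(2) that] vs(3) by (simp add: eq_neg_iff_add_eq_0)
    then have "v * A = - ((-1) ^ r * (A * v))"
      unfolding xA
      by (cases r rule: neg_one_power_cases[where 'a='a]) (simp_all add: vs(4) mult.assoc)
    then show ?thesis using that vs(2) by (auto simp: K_def orthogonal_list_def)
  qed
  moreover have "p + q \<in> K" if "p \<in> K" "q \<in> K" for p q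
    using that by (simp add: K_def vector_add distrib_left distrib_right)
  moreover have "d * p \<in> K" if "d \<in> G0" "p \<in> K" for d p
    using that scalar_left_commute[OF that(1), of A p]
    by (cases r rule: neg_one_power_cases[where 'a='a])
      (simp_all add: K_def vector_scale mult.assoc)
  moreover have "0 \<in> K" "K \<subseteq> G1" by (auto simp: K_def vector_zero)
  moreover have "v * v \<noteq> 0" if "v \<in> set vs" for v
    using invertible_blade_factor_square vs assms(2) that by blast
  ultimately obtain p where p: "p \<in> K" "\<And>u. u \<in> set vs \<Longrightarrow> (a - p) * u + u * (a - p) = 0"
    using orthogonal_decomposition[OF assms(3) vs(2), of K] by blast
  define q where "q = a - p"
  have "q * prod_list vs = (-1) ^ r * (prod_list vs * q)"
    using anticommute_prod_list[of vs q] p(2) vs(3) by (simp add: q_def)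
  then have qA: "q * A = (-1) ^ r * (A * q)"
    unfolding xA
    by (cases r rule: neg_one_power_cases[where 'a='a]) (simp_all add: vs(4) mult.assoc)
  have pG: "p \<in> G1" and pA: "p * A = - ((-1) ^ r * (A * p))" using p by (auto simp: K_def)
  have a: "a = p + q" by (simp add: q_def)
  note A = blades_subset_multivecs[OF assms(1)]
  have inv: "x * A * mult_inv A = x" for x
    using mult_inv_right[OF assms(2)] by (simp add: mult.assoc)
  have "a * A - (-1) ^ r * (A * a) = p * A + p * A"
    using pA qA by (simp add: a algebra_simps)
  then have "projection G0 G1 A a = p"
    using contraction_vector[OF assms(3) A] by (simp add: projection_def half_double inv)
  moreover have "a * A + (-1) ^ r * (A * a) = q * A + q * A"
    using pA qA by (simp add: a algebra_simps)
  then have "rejection G0 G1 A a = q"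
    using wedge_vector[OF assms(3) A] by (simp add: rejection_def half_double inv)
  moreover have "q \<in> G1" using assms(3) pG by (simp add: q_def vector_diff)
  ultimately show ?thesis using that pG qA pA a by blast
qed

text \<open>
  The sign \<open>e\<close> is \<open>1\<close> for contraction and projection and \<open>- 1\<close> for the outer product and
  rejection; \<open>f\<close> is the map \<open>B \<mapsto> B \<rfloor> A\<close> or \<open>B \<mapsto> B \<and> A\<close>.
\<close>

lemma wedge_list_map_mult:
  fixes A e :: 'a and \<pi> f :: "'a \<Rightarrow> 'a" and r :: nat
  defines "Q \<equiv> {q \<in> G1. q * A = e * (-1) ^ r * (A * q)}"
  assumes inv: "A * A' = 1" and e: "e = 1 \<or> e = - 1"
    and \<pi>: "\<And>b. b \<in> G1 \<Longrightarrow> \<pi> b \<in> G1"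
      "\<And>b. b \<in> G1 \<Longrightarrow> \<pi> b * A = - (e * (-1) ^ r * (A * \<pi> b))"
      "\<And>b. b \<in> G1 \<Longrightarrow> b - \<pi> b \<in> Q"
    and f: "\<And>b. b \<in> G1 \<Longrightarrow> f b = \<pi> b * A"
      "\<And>b B s. b \<in> G1 \<Longrightarrow> B \<in> G s \<Longrightarrow>
         f (wedge G0 G1 b B) = mult_inv 2 * (b * f B - e * (-1) ^ (r + s) * (f B * b))"
    and bs: "bs \<noteq> []" "set bs \<subseteq> G1"
  shows "wedge_list G0 G1 bs \<in> G (length bs) \<and>
    wedge_list G0 G1 (map \<pi> bs) \<in> G (length bs) \<and>
    (\<forall>q\<in>Q. q * wedge_list G0 G1 (map \<pi> bs)
       = (-1) ^ length bs * (wedge_list G0 G1 (map \<pi> bs) * q)) \<and>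
    f (wedge_list G0 G1 bs) = wedge_list G0 G1 (map \<pi> bs) * A"
proof -
  \<comment> \<open>The vectors \<open>\<pi> b\<close> and \<open>q\<close> pass \<open>A\<close>
    with opposite signs, so the scalar \<open>?c\<close> anticommutes with \<open>A\<close>. It is
    also central, hence \<open>?c * A = 0\<close>, and \<open>A'\<close> cancels
    \<open>A\<close>.\<close>
  have anti: "q * \<pi> b = - (\<pi> b * q)" if "q \<in> Q" "b \<in> G1" for q b
  proof -
    let ?p = "\<pi> b" and ?c = "\<pi> b * q + q * \<pi> b"
    define g where "g = e * (-1) ^ r"
    have g: "g = 1 \<or> g = - 1"
      using e by (cases r rule: neg_one_power_cases[where 'a='a]) (auto simp: g_def)
    have p: "?p * A = - (g * (A * ?p))" and q: "q * A = g * (A * q)"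
      using \<pi>(2) that by (auto simp: Q_def g_def)
    have "?p * q * A = - (A * (?p * q))"
      using g p q by (auto simp: mult.assoc) (auto simp flip: mult.assoc)
    moreover have "q * ?p * A = - (A * (q * ?p))"
      using g p q by (auto simp: mult.assoc) (auto simp flip: mult.assoc)
    ultimately have "?c * A = - (A * ?c)" by (simp add: distrib_left distrib_right)
    moreover have "?c \<in> G0" using anticommutator_scalar \<pi>(1) that by (auto simp: Q_def)
    ultimately have "?c * A = - (?c * A)" using scalar_central by metis
    then have "?c * A + ?c * A = 0" using eq_neg_iff_add_eq_0 by blast
    then have "?c * A = 0" by (rule double_eq_0)
    then have "?c * (A * A') = 0" by (simp only: mult.assoc[symmetric] mult_zero_left)
    then show ?thesis using inv by (simp add: eq_neg_iff_add_eq_0 add.commute)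
  qed
  show ?thesis using bs
  proof (induction bs rule: list_nonempty_induct)
    case (single b)
    then show ?case using anti f(1) \<pi>(1) by (simp add: multivecs_vector)
  next
    case (cons b bs)
    define B C s p where "B = wedge_list G0 G1 bs" and "C = wedge_list G0 G1 (map \<pi> bs)"
      and "s = length bs" and "p = \<pi> b"
    define q where "q = b - p"
    have IH: "B \<in> G s" "C \<in> G s" "\<And>q. q \<in> Q \<Longrightarrow> q * C = (-1) ^ s * (C * q)" "f B = C * A"
      using cons by (auto simp: B_def C_def s_def)
    have b: "b \<in> G1" and p: "p \<in> G1" and q: "q \<in> Q"
      using cons.prems \<pi> by (auto simp: p_def q_def)
    have B': "wedge_list G0 G1 (b # bs) = wedge G0 G1 b B"
      using cons.hyps by (cases bs) (auto simp: B_def)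
    have C': "wedge_list G0 G1 (map \<pi> (b # bs)) = wedge G0 G1 p C"
      using cons.hyps by (cases bs) (auto simp: C_def p_def)
    have pC: "wedge G0 G1 p C = mult_inv 2 * (p * C + (-1) ^ s * (C * p))"
      using wedge_vector p IH(2) by blast
    \<comment> \<open>\<open>x\<close> anticommutes with \<open>p\<close> and passes
      \<open>C\<close> with \<open>(-1) ^ s\<close>, so it passes both terms of the outer product
      with one sign more.\<close>
    have "x * wedge G0 G1 p C = (-1) ^ Suc s * (wedge G0 G1 p C * x)" if x: "x \<in> Q" for x
    proof -
      have xp: "x * p = - (p * x)" using anti[OF x b] by (simp add: p_def)
      have "x * (p * C) = - (p * (x * C))" using xp by (simp flip: mult.assoc)
      moreover have "x * (C * p) = - ((-1) ^ s * (C * (p * x)))"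
        using IH(3)[OF x] xp by (simp flip: mult.assoc) (simp add: mult.assoc xp)
      ultimately have "x * (p * C + (-1) ^ s * (C * p))
          = (-1) ^ Suc s * ((p * C + (-1) ^ s * (C * p)) * x)"
        using IH(3)[OF x]
        by (cases s rule: neg_one_power_cases[where 'a='a])
          (simp_all add: distrib_left distrib_right left_diff_distrib right_diff_distrib mult.assoc)
      then show ?thesis
        unfolding pC scalar_left_commute[OF half_scalar]
        by (cases s rule: neg_one_power_cases[where 'a='a]) (simp_all add: mult.assoc)
    qed
    moreover have "f (wedge G0 G1 b B) = wedge G0 G1 p C * A"
    proof -
      have bpq: "b = p + q" by (simp add: q_def)
      have pA: "p * A = - (e * (-1) ^ r * (A * p))" and qA: "q * A = e * (-1) ^ r * (A * q)"
        using \<pi>(2)[OF b] q by (auto simp: p_def Q_def)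
      have qCA: "q * (C * A) = (-1) ^ s * (C * (q * A))"
        using IH(3)[OF q] by (simp flip: mult.assoc)
      \<comment> \<open>\<open>q\<close> passes \<open>C\<close> with \<open>(-1) ^ s\<close> and
        \<open>A\<close> with \<open>e * (-1) ^ r\<close>, so it cancels from the difference for
        \<open>b\<close> below.\<close>
      have "q * (C * A) = e * (-1) ^ (r + s) * (C * A * q)"
        unfolding qCA qA using e
        by (cases s rule: neg_one_power_cases[where 'a='a];
            cases r rule: neg_one_power_cases[where 'a='a]) (auto simp: mult.assoc power_add)
      \<comment> \<open>\<open>p\<close> passes \<open>A\<close> with the opposite sign, which turns
        the difference into twice the outer product of \<open>p\<close> and
        \<open>C\<close>.\<close>
      moreover have "p * (C * A) - e * (-1) ^ (r + s) * (C * A * p)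
          = (p * C + (-1) ^ s * (C * p)) * A"
        unfolding distrib_right mult.assoc pA using e
        by (cases s rule: neg_one_power_cases[where 'a='a];
            cases r rule: neg_one_power_cases[where 'a='a]) (auto simp: mult.assoc power_add)
      ultimately have "b * (C * A) - e * (-1) ^ (r + s) * (C * A * b)
          = (p * C + (-1) ^ s * (C * p)) * A"
        by (simp add: bpq distrib_left distrib_right algebra_simps)
      then show ?thesis
        using f(2)[OF b IH(1)] by (simp add: IH(4) pC mult.assoc)
    qed
    ultimately show ?case
      unfolding B' C'
      using wedge_in[OF multivecs_vector[OF b] IH(1)] wedge_in[OF multivecs_vector[OF p] IH(2)]
      by (simp add: s_def)
  qed
qed

section \<open>Outer products of projections and of rejections\<close>

text \<open>Two instances of \<open>wedge_list_map_mult\<close>: \<open>e = 1\<close> for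
  projections and \<open>e = - 1\<close> for rejections. In each, \<open>b\<close> minus its image
  is the complementary part given by \<open>projection_rejection_split\<close>.\<close>

lemma wedge_list_projection_rejection:
  assumes A: "A \<in> blades G0 G1 r" "mult_invertible A" and bs: "bs \<noteq> []" "set bs \<subseteq> G1"
  shows "wedge_list G0 G1 (map (projection G0 G1 A) bs)
           = contraction G0 G1 (wedge_list G0 G1 bs) A * mult_inv A"
    and "wedge_list G0 G1 (map (rejection G0 G1 A) bs)
           = wedge G0 G1 (wedge_list G0 G1 bs) A * mult_inv A"
proof -
  note AG = blades_subset_multivecs[OF A(1)]
  have inv: "A * mult_inv A = 1" "mult_inv A * A = 1"
    using A(2) mult_inv_right mult_inv_left by blast+
  have 1: "contraction G0 G1 (wedge_list G0 G1 bs) A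
      = wedge_list G0 G1 (map (projection G0 G1 A) bs) * A"
  proof (rule wedge_list_map_mult[of A "mult_inv A" 1 "projection G0 G1 A" r
      "\<lambda>B. contraction G0 G1 B A" bs, THEN conjunct2, THEN conjunct2, THEN conjunct2])
    fix b assume b: "b \<in> G1"
    obtain p q where pq: "p \<in> G1" "q \<in> G1" "b = p + q"
      "p * A = - ((-1) ^ r * (A * p))" "q * A = (-1) ^ r * (A * q)" "projection G0 G1 A b = p"
      using projection_rejection_split[OF A b] by metis
    show "projection G0 G1 A b \<in> G1"
      "projection G0 G1 A b * A = - (1 * (-1) ^ r * (A * projection G0 G1 A b))"
      "b - projection G0 G1 A b \<in> {q \<in> G1. q * A = 1 * (-1) ^ r * (A * q)}"
      using pq by auto
    show "contraction G0 G1 b A = projection G0 G1 A b * A"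
      using inv by (simp add: projection_def mult.assoc)
    fix B s assume "B \<in> G s"
    then show "contraction G0 G1 (wedge G0 G1 b B) A = mult_inv 2 *
        (b * contraction G0 G1 B A - 1 * (-1) ^ (r + s) * (contraction G0 G1 B A * b))"
      using contraction_wedge_vector_formula b AG by simp
  qed (use inv bs in auto)
  have 2: "wedge G0 G1 (wedge_list G0 G1 bs) A
      = wedge_list G0 G1 (map (rejection G0 G1 A) bs) * A"
  proof (rule wedge_list_map_mult[of A "mult_inv A" "- 1" "rejection G0 G1 A" r
      "\<lambda>B. wedge G0 G1 B A" bs, THEN conjunct2, THEN conjunct2, THEN conjunct2])
    fix b assume b: "b \<in> G1"
    obtain p q where pq: "p \<in> G1" "q \<in> G1" "b = p + q"
      "p * A = - ((-1) ^ r * (A * p))" "q * A = (-1) ^ r * (A * q)" "rejection G0 G1 A b = q"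
      using projection_rejection_split[OF A b] by metis
    show "rejection G0 G1 A b \<in> G1"
      "rejection G0 G1 A b * A = - (- 1 * (-1) ^ r * (A * rejection G0 G1 A b))"
      "b - rejection G0 G1 A b \<in> {q \<in> G1. q * A = - 1 * (-1) ^ r * (A * q)}"
      using pq by auto
    show "wedge G0 G1 b A = rejection G0 G1 A b * A"
      using inv by (simp add: rejection_def mult.assoc)
    fix B s assume "B \<in> G s"
    then show "wedge G0 G1 (wedge G0 G1 b B) A = mult_inv 2 *
        (b * wedge G0 G1 B A - - 1 * (-1) ^ (r + s) * (wedge G0 G1 B A * b))"
      using wedge_wedge_vector_formula b AG by simp
  qed (use inv bs in auto)
  show "wedge_list G0 G1 (map (projection G0 G1 A) bs)
           = contraction G0 G1 (wedge_list G0 G1 bs) A * mult_inv A"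
    "wedge_list G0 G1 (map (rejection G0 G1 A) bs)
           = wedge G0 G1 (wedge_list G0 G1 bs) A * mult_inv A"
    unfolding 1 2 using inv by (simp_all add: mult.assoc)
qed

end

theorem theorem32:
  fixes G0 G1 :: "'a::ring_char_0 set" and A :: 'a and r :: nat and bs :: "'a list"
  assumes "geometric_algebra G0 G1"
    and "A \<in> blades G0 G1 r"
    and "mult_invertible A"
    and "bs \<noteq> []"
    and "set bs \<subseteq> G1"
  shows "wedge_list G0 G1 (map (projection G0 G1 A) bs)
           = contraction G0 G1 (wedge_list G0 G1 bs) A * mult_inv A
       \<and> wedge_list G0 G1 (map (rejection G0 G1 A) bs)
           = wedge G0 G1 (wedge_list G0 G1 bs) A * mult_inv A"
  using geometric_algebra.wedge_list_projection_rejection[OF assms] by blast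

end
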